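(* Let $D$ be a complete valued division ring of characteristic $0$ whose unit sphere $\{d\in D:|d|=1\}$ is compact. Let $f:D\to D$ be differentiable in the Gâteaux sense at a point $x\in D$, and let $\frac{\partial f(x)(a)}{\partial_* x}$ ($a\in D$, $a\ne 0$) be its Gâteaux $D\star$-derivative. If the map $a\mapsto \frac{\partial f(x)(a)}{\partial_* x}$ is continuous in direction over $\mathbb R$, then the norm $\|\partial f(x)\|$ of the Gâteaux derivative exists, i.e. $$\|\partial f(x)\|=\sup_{a\ne 0}\frac{|\partial f(x)(a)|}{|a|}<\infty .$$
   Context: A valued division ring is a division ring $D$ with a map $|\cdot|:D\to\mathbb R$ satisfying $|a|\ge0$, $|a|=0\iff a=0$, $|ab|=|a||b|$, $|a+b|\le|a|+|b|$. It is assumed that $|\cdot|$ restricts to the usual absolute value on $\mathbb Q\subset D$; since $D$ is complete, $\mathbb R$ is then contained in the center of $D$. The map $f$ is differentiable in the Gâteaux sense at $x$ if $f(x+a)-f(x)=\partial f(x)(a)+o(a)$ for all $a$, where the Gâteaux derivative $\partial f(x):D\to D$ is an $\mathbb R$-linear map and $o:D\to D$ is a continuous map with $\lim_{a\to0}|o(a)|/|a|=0$. The Gâteaux $D\star$-derivative is defined by $\partial f(x)(a)=a\,\frac{\partial f(x)(a)}{\partial_* x}$, i.e. $\frac{\partial f(x)(a)}{\partial_* x}=a^{-1}\partial f(x)(a)$ for $a\neq0$; it does not change when $a$ is replaced by $ra$, $r\in\mathbb R$, $r\neq0$. A map $\varphi$ on $D\setminus\{0\}$ with $\varphi(ra)=\varphi(a)$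 for nonzero real $r$ is continuous in direction over $\mathbb R$ if for every $\epsilon>0$ there is $\delta>0$ such that $|a'-a|<\delta$, $|a'|=|a|=1$ imply $|\varphi(a')-\varphi(a)|<\epsilon$ (equivalently, $\varphi$ is continuous on the unit sphere). *)

theory Defs
  imports "HOL-Analysis.Analysis"
begin

(* The metric, and with it the topology, is the one induced by the absolute
   value. The library constant norm is not used, as its type is restricted to
   real normed vector spaces, whereas here the reals are only found inside the
   ring by completeness. Completeness itself is the library class
   complete_space. *)

class valued_division_ring = division_ring + ring_char_0 + metric_space +
  fixes vabs :: "'a \<Rightarrow> real"
  assumes dist_vabs: "dist a b = vabs (a - b)"
    and vabs_ge_zero: "0 \<le> vabs a"
    and vabs_eq_zero: "vabs a = 0 \<longleftrightarrow> a = 0"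
    and vabs_mult: "vabs (a * b) = vabs a * vabs b"
    and vabs_triangle: "vabs (a + b) \<le> vabs a + vabs b"
    and vabs_rat: "vabs (of_int p / of_int q) = \<bar>of_int p / of_int q :: real\<bar>"

instantiation real :: valued_division_ring
begin

definition vabs_real :: "real \<Rightarrow> real" where
  "vabs_real x = \<bar>x\<bar>"

instance
  by standard (simp_all add: vabs_real_def dist_real_def abs_mult abs_triangle_ineq)

end

(* The embedding of the reals into a complete D: the limit in D of rational
   numbers converging to r, see real_in_D_limit below. The library function
   of_real is not available, as D is not given with the structure of a
   real algebra. *)

definition rat_approx :: "real \<Rightarrow> nat \<Rightarrow> 'a :: valued_division_ring" where
  "rat_approx r n = of_int \<lfloor>r * real (Suc n)\<rfloor> / of_int (int (Suc n))"

definition real_in_D :: "real \<Rightarrow> 'a :: valued_division_ring" where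
  "real_in_D r = lim (rat_approx r)"

lemma of_int_div_diff:
  fixes p q p' q' :: int
  assumes "q \<noteq> 0" "q' \<noteq> 0"
  shows "(of_int p / of_int q :: 'a :: valued_division_ring) - of_int p' / of_int q'
    = of_int (p * q' - p' * q) / of_int (q * q')"
proof -
  have inv: "inverse (of_int (q * q')) = inverse (of_int q') * (inverse (of_int q) :: 'a)"
    using assms unfolding of_int_mult by (simp add: nonzero_inverse_mult_distrib)
  have nz: "(of_int q :: 'a) \<noteq> 0" "(of_int q' :: 'a) \<noteq> 0" using assms by simp_all
  have "of_int (p * q') / of_int (q * q')
      = of_int p * (of_int q' * inverse (of_int q')) * (inverse (of_int q) :: 'a)"
    unfolding divide_inverse inv by (simp only: of_int_mult mult.assoc)
  then have 1: "of_int (p * q') / of_int (q * q') = (of_int p / of_int q :: 'a)"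
    using nz by (simp add: divide_inverse)
  have inv': "inverse (of_int (q * q')) = inverse (of_int q) * (inverse (of_int q') :: 'a)"
    using nz unfolding mult.commute[of q q'] of_int_mult by (simp add: nonzero_inverse_mult_distrib)
  have "of_int (p' * q) / of_int (q * q')
      = of_int p' * (of_int q * inverse (of_int q)) * (inverse (of_int q') :: 'a)"
    unfolding divide_inverse inv' by (simp only: of_int_mult mult.assoc)
  then have 2: "of_int (p' * q) / of_int (q * q') = (of_int p' / of_int q' :: 'a)"
    using nz by (simp add: divide_inverse)
  show ?thesis
    unfolding of_int_diff diff_divide_distrib 1 2 ..
qed

lemma dist_of_int_div:
  fixes p q p' q' :: int
  assumes "q \<noteq> 0" "q' \<noteq> 0"
  shows "dist (of_int p / of_int q :: 'a :: valued_division_ring) (of_int p' / of_int q')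
    = \<bar>of_int p / of_int q - of_int p' / of_int q' :: real\<bar>"
proof -
  have "dist (of_int p / of_int q :: 'a) (of_int p' / of_int q')
      = \<bar>of_int (p * q' - p' * q) / of_int (q * q') :: real\<bar>"
    unfolding dist_vabs of_int_div_diff[OF assms] by (rule vabs_rat)
  also have "\<dots> = \<bar>of_int p / of_int q - of_int p' / of_int q'\<bar>"
    using assms by (simp add: field_simps)
  finally show ?thesis .
qed

lemma real_in_D_limit:
  fixes p q :: "nat \<Rightarrow> int"
  assumes "(\<lambda>n. of_int (p n) / of_int (q n)) \<longlonglongrightarrow> r" and q: "\<And>n. q n \<noteq> 0"
  shows "(\<lambda>n. of_int (p n) / of_int (q n))
    \<longlonglongrightarrow> (real_in_D r :: 'a :: {valued_division_ring, complete_space})"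
proof -
  let ?a = "\<lambda>n. of_int \<lfloor>r * real (Suc n)\<rfloor> / of_int (int (Suc n)) :: real"
  have lim_a: "?a \<longlonglongrightarrow> r"
  proof (rule tendsto_sandwich)
    show "\<forall>\<^sub>F n in sequentially. r - 1 / real (Suc n) \<le> ?a n"
    proof (intro always_eventually allI)
      fix n
      have "r * real (Suc n) - 1 \<le> of_int \<lfloor>r * real (Suc n)\<rfloor>" by linarith
      then have "(r * real (Suc n) - 1) / real (Suc n) \<le> ?a n"
        by (simp add: divide_right_mono)
      then show "r - 1 / real (Suc n) \<le> ?a n" by (simp add: diff_divide_distrib)
    qed
    show "\<forall>\<^sub>F n in sequentially. ?a n \<le> r"
      by (intro always_eventually allI) (simp add: divide_le_eq)
    show "(\<lambda>n. r - 1 / real (Suc n)) \<longlonglongrightarrow> r"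
      using tendsto_diff[OF tendsto_const LIMSEQ_inverse_real_of_nat, of r]
      by (simp add: inverse_eq_divide)
  qed simp
  have "Cauchy (rat_approx r :: nat \<Rightarrow> 'a)"
  proof (rule metric_CauchyI)
    fix e :: real assume "0 < e"
    have "Cauchy ?a" using lim_a by (simp add: LIMSEQ_imp_Cauchy)
    then obtain M where "\<forall>m\<ge>M. \<forall>n\<ge>M. dist (?a m) (?a n) < e"
      using metric_CauchyD[OF _ \<open>0 < e\<close>] by blast
    moreover have "dist (rat_approx r m :: 'a) (rat_approx r n) = dist (?a m) (?a n)" for m n
      unfolding rat_approx_def dist_real_def by (rule dist_of_int_div) simp_all
    ultimately show "\<exists>M. \<forall>m\<ge>M. \<forall>n\<ge>M. dist (rat_approx r m :: 'a) (rat_approx r n) < e"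
      by auto
  qed
  then have lim_D: "rat_approx r \<longlonglongrightarrow> (real_in_D r :: 'a)"
    unfolding real_in_D_def by (simp add: Cauchy_convergent convergent_LIMSEQ_iff [symmetric])
  have "(\<lambda>n. \<bar>of_int (p n) / of_int (q n) - ?a n\<bar>) \<longlonglongrightarrow> 0"
    using tendsto_diff[OF assms(1) lim_a] by (simp add: tendsto_rabs_zero)
  moreover have "dist (of_int (p n) / of_int (q n)) (rat_approx r n :: 'a)
      = \<bar>of_int (p n) / of_int (q n) - ?a n\<bar>" for n
    unfolding rat_approx_def using q by (intro dist_of_int_div) simp_all
  ultimately have "(\<lambda>n. dist (of_int (p n) / of_int (q n)) (rat_approx r n :: 'a)) \<longlonglongrightarrow> 0"
    by simp
  from tendsto_add[OF this lim_D[THEN iffD1[OF tendsto_dist_iff]]]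
  have 0: "(\<lambda>n. dist (of_int (p n) / of_int (q n)) (rat_approx r n :: 'a)
      + dist (rat_approx r n) (real_in_D r :: 'a)) \<longlonglongrightarrow> 0" by simp
  show ?thesis
    unfolding tendsto_dist_iff[of _ "real_in_D r"]
    by (rule tendsto_sandwich[OF _ _ tendsto_const 0])
       (simp_all add: dist_triangle always_eventually)
qed

definition real_linear :: "('a :: valued_division_ring \<Rightarrow> 'a) \<Rightarrow> bool" where
  "real_linear L \<longleftrightarrow>
     (\<forall>a b. L (a + b) = L a + L b) \<and> (\<forall>r a. L (real_in_D r * a) = real_in_D r * L a)"

definition has_gateaux_derivative ::
    "('a :: valued_division_ring \<Rightarrow> 'a) \<Rightarrow> ('a \<Rightarrow> 'a) \<Rightarrow> 'a \<Rightarrow> bool" where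
  "has_gateaux_derivative f df x \<longleftrightarrow>
     real_linear df \<and>
     (\<exists>h :: 'a \<Rightarrow> 'a. continuous_on UNIV h \<and>
        ((\<lambda>a. vabs (h a) / vabs a) \<longlongrightarrow> 0) (at 0) \<and>
        (\<forall>a. f (x + a) - f x = df a + h a))"

(* df stands for the Gateaux derivative at the point under consideration;
   only arguments a \<noteq> 0 are meaningful. *)

definition gateaux_star_derivative ::
    "('a :: valued_division_ring \<Rightarrow> 'a) \<Rightarrow> 'a \<Rightarrow> 'a" where
  "gateaux_star_derivative df a = inverse a * df a"

(* Only the values of \<phi> on the unit sphere matter. As in the usual formulation,
   \<delta> depends on \<epsilon> alone; continuous_in_direction_iff shows that on a
   compact unit sphere this is the same as continuity. *)

definition continuous_in_direction :: "('a :: valued_division_ring \<Rightarrow> 'a) \<Rightarrow> bool" where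
  "continuous_in_direction \<phi> \<longleftrightarrow>
     (\<forall>\<epsilon>>0. \<exists>\<delta>>0. \<forall>a a'. vabs (a' - a) < \<delta> \<and> vabs a' = 1 \<and> vabs a = 1 \<longrightarrow>
        vabs (\<phi> a' - \<phi> a) < \<epsilon>)"

lemma continuous_in_direction_iff:
  fixes \<phi> :: "'a :: valued_division_ring \<Rightarrow> 'a"
  assumes "compact {d :: 'a. vabs d = 1}"
  shows "continuous_in_direction \<phi> \<longleftrightarrow> continuous_on {d. vabs d = 1} \<phi>"
proof -
  have "continuous_in_direction \<phi> \<longleftrightarrow> uniformly_continuous_on {d. vabs d = 1} \<phi>"
    unfolding continuous_in_direction_def uniformly_continuous_on_def dist_vabs
    by (intro iff_allI imp_cong arg_cong[where f = Ex] ext conj_cong refl) auto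
  then show ?thesis
    using assms compact_uniformly_continuous uniformly_continuous_imp_continuous by blast
qed

definition gateaux_norm :: "('a :: valued_division_ring \<Rightarrow> 'a) \<Rightarrow> ereal" where
  "gateaux_norm df = (SUP a \<in> - {0}. ereal (vabs (df a) / vabs a))"

end

theory Submission
  imports Defs
begin

text \<open>
  The absolute value extends the usual one from \<open>\<rat>\<close> to \<open>\<real> \<subseteq> D\<close> by continuity, so every
  nonzero \<open>a\<close> has a real multiple \<open>b = r a\<close> with \<open>r = 1 / |a|\<close> on the unit sphere. The derivative
  is real linear and the absolute value is multiplicative, so the quotient \<open>|df a| / |a|\<close> is the
  same at \<open>a\<close> and at \<open>b\<close>, where it is the absolute value of the star derivative. The supremum over
  all nonzero \<open>a\<close> is thus a supremum over the unit sphere of a continuous function, which is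
  bounded because the sphere is compact. The lemma \<open>real_linear_quotient_on_sphere\<close> carries the
  reduction to the sphere, \<open>vabs_real_in_D\<close> the extension of the absolute value.
\<close>

lemma vabs_conv_dist: "vabs a = dist a 0"
  by (simp add: dist_vabs)

lemma floor_approx_LIMSEQ: "(\<lambda>n. of_int \<lfloor>r * real (Suc n)\<rfloor> / of_int (int (Suc n))) \<longlonglongrightarrow> r"
  (is "?f \<longlonglongrightarrow> r")
proof (rule LIM_zero_cancel, rule Lim_null_comparison[OF _ LIMSEQ_inverse_real_of_nat],
    intro always_eventually allI)
  fix n
  have "?f n - r = (of_int \<lfloor>r * real (Suc n)\<rfloor> - r * real (Suc n)) / real (Suc n)"
    by (simp add: diff_divide_distrib)
  then have "norm (?f n - r) = \<bar>of_int \<lfloor>r * real (Suc n)\<rfloor> - r * real (Suc n)\<bar> / real (Suc n)"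
    by (simp only: real_norm_def abs_divide abs_of_nat)
  also have "\<dots> \<le> 1 / real (Suc n)"
    by (intro divide_right_mono of_nat_0_le_iff) linarith
  finally show "norm (?f n - r) \<le> inverse (real (Suc n))"
    by (simp only: inverse_eq_divide)
qed

text \<open>The identity holds for the rational numbers approximating \<open>r\<close>, and the absolute value is
  continuous, so it passes to the limit.\<close>

lemma vabs_real_in_D:
  "vabs (real_in_D r :: 'a :: {valued_division_ring, complete_space}) = \<bar>r\<bar>"
proof -
  let ?p = "\<lambda>n. \<lfloor>r * real (Suc n)\<rfloor>" and ?q = "\<lambda>n. int (Suc n)"
  have "(\<lambda>n. of_int (?p n) / of_int (?q n)) \<longlonglongrightarrow> (real_in_D r :: 'a)"
    by (rule real_in_D_limit[OF floor_approx_LIMSEQ]) simp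
  then have "(\<lambda>n. vabs (of_int (?p n) / of_int (?q n) :: 'a)) \<longlonglongrightarrow> vabs (real_in_D r :: 'a)"
    unfolding vabs_conv_dist by (intro tendsto_dist tendsto_const)
  then have "(\<lambda>n. \<bar>of_int (?p n) / of_int (?q n) :: real\<bar>) \<longlonglongrightarrow> vabs (real_in_D r :: 'a)"
    unfolding vabs_rat .
  moreover have "(\<lambda>n. \<bar>of_int (?p n) / of_int (?q n) :: real\<bar>) \<longlonglongrightarrow> \<bar>r\<bar>"
    by (intro tendsto_rabs floor_approx_LIMSEQ)
  ultimately show ?thesis
    by (rule LIMSEQ_unique)
qed

lemma vabs_gateaux_star_derivative:
  assumes "a \<noteq> 0"
  shows "vabs (gateaux_star_derivative L a) = vabs (L a) / vabs a"
proof -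
  have "vabs a * vabs (gateaux_star_derivative L a) = vabs (L a)"
    using assms unfolding gateaux_star_derivative_def vabs_mult[symmetric]
    by (simp add: mult.assoc[symmetric])
  moreover have "vabs a \<noteq> 0"
    using assms by (simp add: vabs_eq_zero)
  ultimately show ?thesis
    by (simp add: field_simps)
qed

text \<open>Scaling by \<open>1 / |a|\<close> shows that a real linear map takes no larger quotients anywhere than
  on the unit sphere.\<close>

lemma real_linear_quotient_on_sphere:
  fixes a :: "'a :: {valued_division_ring, complete_space}"
  assumes "real_linear L" "a \<noteq> 0"
  obtains b where "vabs b = 1" "vabs (L a) / vabs a = vabs (gateaux_star_derivative L b)"
proof
  let ?b = "real_in_D (1 / vabs a) * a"
  have pos: "vabs a > 0"
    using assms(2) vabs_ge_zero[of a] vabs_eq_zero[of a] by linarith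
  show b: "vabs ?b = 1"
    using pos by (simp add: vabs_mult vabs_real_in_D)
  then have "?b \<noteq> 0"
    using vabs_eq_zero[of ?b] by linarith
  then have "vabs (gateaux_star_derivative L ?b) = vabs (L ?b)"
    by (simp add: vabs_gateaux_star_derivative b)
  also have "L ?b = real_in_D (1 / vabs a) * L a"
    using assms(1) by (simp add: real_linear_def)
  finally show "vabs (L a) / vabs a = vabs (gateaux_star_derivative L ?b)"
    using pos by (simp add: vabs_mult vabs_real_in_D)
qed

lemma gateaux_norm_finite_of_real_linear:
  fixes L :: "'a :: {valued_division_ring, complete_space} \<Rightarrow> 'a"
  assumes "compact {d :: 'a. vabs d = 1}"
    and "real_linear L"
    and "continuous_in_direction (gateaux_star_derivative L)"
  shows "gateaux_norm L < \<infinity>"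
proof -
  have "continuous_on {d. vabs d = 1} (gateaux_star_derivative L)"
    using assms(1,3) by (simp add: continuous_in_direction_iff)
  then have "bounded (gateaux_star_derivative L ` {d. vabs d = 1})"
    using assms(1) by (intro compact_imp_bounded compact_continuous_image)
  then obtain B where B: "\<And>b. vabs b = 1 \<Longrightarrow> vabs (gateaux_star_derivative L b) \<le> B"
    unfolding bounded_any_center[of _ 0] by (auto simp: vabs_conv_dist dist_commute)
  have "vabs (L a) / vabs a \<le> B" if "a \<noteq> 0" for a
    using real_linear_quotient_on_sphere[OF assms(2) that] B by metis
  then have "gateaux_norm L \<le> ereal B"
    unfolding gateaux_norm_def by (intro SUP_least) simp
  also have "ereal B < \<infinity>"
    by simp
  finally show ?thesis .
qed

theorem theorem5p2p17:
  fixes f df :: "'a :: {valued_division_ring, complete_space} \<Rightarrow> 'a" and x :: 'a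
  assumes "compact {d :: 'a. vabs d = 1}"
    and "has_gateaux_derivative f df x"
    and "continuous_in_direction (gateaux_star_derivative df)"
  shows "gateaux_norm df < \<infinity>"
proof (rule gateaux_norm_finite_of_real_linear[OF assms(1) _ assms(3)])
  show "real_linear df"
    using assms(2) by (simp add: has_gateaux_derivative_def)
qed

end
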